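(* Let $n\ge 2$ and let $\mathcal{T}$ be a tree on the vertex set $\{1,\dots,n\}$. Then $$\kappa(\mathcal{T})=\frac{\mathbf{1}^TF_{\mathcal{T}}\mathbf{1}}{n-1}-\frac{2n-1}{2}=\frac{2W(\mathcal{T})}{n-1}-n+\frac12 .$$
   Context: Graphs are finite, simple and undirected. Let $G$ be a connected graph with vertex set $\{1,\dots,n\}$, $n\ge2$. Let $m_G$ be its number of edges, $\tau_G$ its number of spanning trees, and $\mathbf{d}_G$ the column vector whose $i$-th entry is the degree of vertex $i$. A 2-tree spanning forest of $G$ is a spanning subgraph that is a forest with exactly two connected components (trees). Let $f^G_{i,j}$ be the number of 2-tree spanning forests of $G$ in which one of the two trees contains $i$ and the other contains $j$ (so $f^G_{i,i}=0$), and let $F_G=[f^G_{i,j}]_{i,j=1}^n$. Kemeny's constant of (the random walk on) $G$ is $$\kappa(G)=\frac{\mathbf{d}_G^TF_G\mathbf{d}_G}{4m_G\tau_G}.$$ The Wiener index of $G$ is $W(G)=\frac12\mathbf{1}^TD\mathbf{1}$, where $D=[\mathrm{dist}_G(i,j)]_{i,j=1}^n$ is the distance matrix and $\mathbf{1}$ is the all-ones vector; that is, $W(G)$ is the sum of the distances over all unordered pairs of vertices. *)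

theory Defs
  imports Complex_Main "Jordan_Normal_Form.Matrix"
begin

(* A graph is given by its vertex set V and its set E of edges, each edge being a set of
   two vertices. *)

definition simple_graph :: "'a set \<Rightarrow> 'a set set \<Rightarrow> bool" where
  "simple_graph V E \<longleftrightarrow> finite V \<and> (\<forall>e\<in>E. e \<subseteq> V \<and> card e = 2)"

(* Walks are nonempty vertex lists; the walk xs has length xs - 1 edges. *)
definition walk :: "'a set \<Rightarrow> 'a set set \<Rightarrow> 'a list \<Rightarrow> bool" where
  "walk V E xs \<longleftrightarrow> xs \<noteq> [] \<and> set xs \<subseteq> V \<and> (\<forall>i. Suc i < length xs \<longrightarrow> {xs ! i, xs ! Suc i} \<in> E)"

definition walk_betw :: "'a set \<Rightarrow> 'a set set \<Rightarrow> 'a \<Rightarrow> 'a list \<Rightarrow> 'a \<Rightarrow> bool" where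
  "walk_betw V E u xs v \<longleftrightarrow> walk V E xs \<and> hd xs = u \<and> last xs = v"

definition reachable :: "'a set \<Rightarrow> 'a set set \<Rightarrow> 'a \<Rightarrow> 'a \<Rightarrow> bool" where
  "reachable V E u v \<longleftrightarrow> (\<exists>xs. walk_betw V E u xs v)"

definition components :: "'a set \<Rightarrow> 'a set set \<Rightarrow> 'a set set" where
  "components V E = {{v \<in> V. reachable V E u v} | u. u \<in> V}"

definition connected_graph :: "'a set \<Rightarrow> 'a set set \<Rightarrow> bool" where
  "connected_graph V E \<longleftrightarrow> simple_graph V E \<and> V \<noteq> {} \<and> (\<forall>u\<in>V. \<forall>v\<in>V. reachable V E u v)"

(* The closing edge is {last xs, hd xs}; length at least 3 excludes traversing one edge
   back and forth. *)
definition cycle :: "'a set \<Rightarrow> 'a set set \<Rightarrow> 'a list \<Rightarrow> bool" where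
  "cycle V E xs \<longleftrightarrow> walk V E xs \<and> distinct xs \<and> 3 \<le> length xs \<and> {last xs, hd xs} \<in> E"

definition forest :: "'a set \<Rightarrow> 'a set set \<Rightarrow> bool" where
  "forest V E \<longleftrightarrow> simple_graph V E \<and> (\<nexists>xs. cycle V E xs)"

definition tree :: "'a set \<Rightarrow> 'a set set \<Rightarrow> bool" where
  "tree V E \<longleftrightarrow> connected_graph V E \<and> forest V E"

(* Junk value if v is not reachable from u. *)
definition graph_dist :: "'a set \<Rightarrow> 'a set set \<Rightarrow> 'a \<Rightarrow> 'a \<Rightarrow> nat" where
  "graph_dist V E u v = (LEAST k. \<exists>xs. walk_betw V E u xs v \<and> length xs = Suc k)"

definition degree :: "'a set set \<Rightarrow> 'a \<Rightarrow> nat" where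
  "degree E v = card {e \<in> E. v \<in> e}"

(* Spanning subgraphs of (V, E) have vertex set V, hence are identified with subsets of E. *)

definition spanning_trees :: "'a set \<Rightarrow> 'a set set \<Rightarrow> 'a set set set" where
  "spanning_trees V E = {H. H \<subseteq> E \<and> tree V H}"

definition two_tree_forests :: "'a set \<Rightarrow> 'a set set \<Rightarrow> 'a set set set" where
  "two_tree_forests V E = {H. H \<subseteq> E \<and> forest V H \<and> card (components V H) = 2}"

definition num_separating_forests :: "'a set \<Rightarrow> 'a set set \<Rightarrow> 'a \<Rightarrow> 'a \<Rightarrow> nat" where
  "num_separating_forests V E i j =
     card {H \<in> two_tree_forests V E.
       \<exists>A\<in>components V H. \<exists>B\<in>components V H. A \<noteq> B \<and> i \<in> A \<and> j \<in> B}"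

(* For a graph on the vertices 1, ..., n, given by its edge set E. Library vectors and
   matrices are indexed from 0, so index i belongs to vertex Suc i. *)

definition degree_vec :: "nat \<Rightarrow> nat set set \<Rightarrow> real vec" where
  "degree_vec n E = vec n (\<lambda>i. real (degree E (Suc i)))"

definition ones_vec :: "nat \<Rightarrow> real vec" where
  "ones_vec n = vec n (\<lambda>_. 1)"

definition forest_mat :: "nat \<Rightarrow> nat set set \<Rightarrow> real mat" where
  "forest_mat n E =
     mat n n (\<lambda>(i, j). real (num_separating_forests {1..n} E (Suc i) (Suc j)))"

definition distance_mat :: "nat \<Rightarrow> nat set set \<Rightarrow> real mat" where
  "distance_mat n E = mat n n (\<lambda>(i, j). real (graph_dist {1..n} E (Suc i) (Suc j)))"

definition kemeny :: "nat \<Rightarrow> nat set set \<Rightarrow> real" where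
  "kemeny n E =
     (degree_vec n E \<bullet> (forest_mat n E *\<^sub>v degree_vec n E)) /
     (4 * real (card E) * real (card (spanning_trees {1..n} E)))"

definition wiener_index :: "nat \<Rightarrow> nat set set \<Rightarrow> real" where
  "wiener_index n E = 1 / 2 * (ones_vec n \<bullet> (distance_mat n E *\<^sub>v ones_vec n))"

end

(* Removing an edge e from a tree leaves exactly two components, and these are all the 2-tree
   spanning forests, so f(i,j) is the number s(i,j) of edges whose removal separates i from j.
   Along a path s(-,j) changes by exactly one at each edge, whence s is the distance.
   Rooting the tree at j and sending each edge to its endpoint farther from j is a bijection onto
   the vertices other than j; summing s(-,j) over the endpoints of all edges yields
   sum_i d(i) s(i,j) = 2 sum_i s(i,j) - (n - 1). Applying this identity twice evaluates
   d^T F d. *)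
theory Submission
  imports Defs
begin

section \<open>Reachability\<close>

text \<open>Encoding connectivity by the closure \<open>(adj E)\<^sup>*\<close> gives access to
  \<open>rtrancl\<close> inductions. The relation does not mention V, so deleting an edge changes
  nothing but E.\<close>

definition adj :: "'a set set \<Rightarrow> ('a \<times> 'a) set" where
  "adj E = {(x, y). {x, y} \<in> E}"

lemma adj_iff [simp]: "(x, y) \<in> adj E \<longleftrightarrow> {x, y} \<in> E"
  by (simp add: adj_def)

lemma linked_sym: "(x, y) \<in> (adj E)\<^sup>* \<Longrightarrow> (y, x) \<in> (adj E)\<^sup>*"
  by (rule symD[OF sym_rtrancl]) (auto simp: sym_def insert_commute)

lemma linked_left_cong:
  assumes "(x, y) \<in> (adj E)\<^sup>*"
  shows "(x, z) \<in> (adj E)\<^sup>* \<longleftrightarrow> (y, z) \<in> (adj E)\<^sup>*"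
  using rtrancl_trans[OF assms] rtrancl_trans[OF linked_sym[OF assms]] by blast

lemma linked_mono: "(x, y) \<in> (adj E)\<^sup>* \<Longrightarrow> E \<subseteq> E' \<Longrightarrow> (x, y) \<in> (adj E')\<^sup>*"
  using rtrancl_mono[of "adj E" "adj E'"] by (auto simp: adj_def)

lemma edge_linked: "{x, y} \<in> E \<Longrightarrow> (x, y) \<in> (adj E)\<^sup>*"
  by (simp add: r_into_rtrancl)

lemma simple_graph_subset: "simple_graph V E \<Longrightarrow> H \<subseteq> E \<Longrightarrow> simple_graph V H"
  by (auto simp: simple_graph_def)

lemma simple_graph_finite_edges: "simple_graph V E \<Longrightarrow> finite E"
  unfolding simple_graph_def by (meson PowI finite_Pow_iff finite_subset subsetI)

lemma simple_graph_edgeD: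
  assumes "simple_graph V E" and "{x, y} \<in> E"
  shows "x \<in> V" "y \<in> V" "x \<noteq> y"
  using assms by (auto simp: simple_graph_def)

lemma simple_graph_edgeE:
  assumes "simple_graph V E" and "e \<in> E"
  obtains x y where "e = {x, y}" "x \<noteq> y" "x \<in> V" "y \<in> V"
  using assms by (auto simp: simple_graph_def card_2_iff)

section \<open>Walks and linked vertices\<close>

lemma walk_singleton [simp]: "walk V E [x] \<longleftrightarrow> x \<in> V"
  by (simp add: walk_def)

lemma walk_Cons2 [simp]:
  "walk V E (x # y # ys) \<longleftrightarrow> x \<in> V \<and> {x, y} \<in> E \<and> walk V E (y # ys)"
  (is "?l \<longleftrightarrow> ?r")
proof
  assume l: ?l
  then have "{(x # y # ys) ! 0, (x # y # ys) ! Suc 0} \<in> E"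
    unfolding walk_def by (metis length_Cons Suc_less_eq zero_less_Suc)
  moreover have "{(y # ys) ! i, (y # ys) ! Suc i} \<in> E" if "Suc i < length (y # ys)" for i
    using l that unfolding walk_def by (auto dest: spec[of _ "Suc i"])
  ultimately show ?r using l by (auto simp: walk_def)
next
  assume r: ?r
  have "{(x # y # ys) ! i, (x # y # ys) ! Suc i} \<in> E" if "Suc i < length (x # y # ys)" for i
    using r that unfolding walk_def by (cases i) auto
  then show ?l using r by (auto simp: walk_def)
qed

lemma walk_suffix: "walk V E (ys @ x # zs) \<Longrightarrow> walk V E (x # zs)"
proof (induction ys)
  case (Cons y ys)
  then show ?case by (cases ys) auto
qed simp

lemma walk_linked_hd: "walk V E xs \<Longrightarrow> x \<in> set xs \<Longrightarrow> (hd xs, x) \<in> (adj E)\<^sup>*"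
proof (induction xs rule: induct_list012)
  case (3 a b xs)
  then show ?case by (auto intro: converse_rtrancl_into_rtrancl)
qed auto

lemma walk_linked: "walk_betw V E u xs v \<Longrightarrow> (u, v) \<in> (adj E)\<^sup>*"
  unfolding walk_betw_def by (metis last_in_set walk_def walk_linked_hd)

text \<open>Turns avoidance of a vertex into survival of the walk when all edges at that vertex are
  deleted.\<close>

lemma walk_avoid:
  assumes "walk V E xs" and "i \<notin> set xs"
  shows "walk V {e \<in> E. i \<notin> e} xs"
  using assms unfolding walk_def
  by (metis (no_types, lifting) Suc_lessD insertE mem_Collect_eq nth_mem singletonD)

lemma walk_mono: "walk V H xs \<Longrightarrow> H \<subseteq> E \<Longrightarrow> walk V E xs"
  by (auto simp: walk_def)

text \<open>A path is built backwards from v. If the new first vertex u already occurs on it, the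
  loop is cut off by keeping only the part from u onwards.\<close>

lemma distinct_walk_exists:
  assumes "simple_graph V E" and "(u, v) \<in> (adj E)\<^sup>*" and "v \<in> V"
  shows "\<exists>xs. walk_betw V E u xs v \<and> distinct xs"
  using assms(2)
proof (induction rule: converse_rtrancl_induct)
  case base
  show ?case by (rule exI[of _ "[v]"]) (simp add: walk_betw_def assms)
next
  case (step u w)
  then obtain xs where xs: "walk_betw V E w xs v" "distinct xs" by blast
  show ?case
  proof (cases "u \<in> set xs")
    case True
    then obtain ys zs where "xs = ys @ u # zs" by (meson split_list)
    then show ?thesis using xs walk_suffix
      by (intro exI[of _ "u # zs"]) (auto simp: walk_betw_def)
  next
    case False
    obtain zs where zs: "xs = w # zs" using xs
      by (cases xs) (auto simp: walk_betw_def walk_def)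
    have "{u, w} \<in> E" using step by simp
    then show ?thesis using xs zs False simple_graph_edgeD[OF assms(1)]
      by (intro exI[of _ "u # xs"]) (auto simp: walk_betw_def)
  qed
qed

lemma linked_in_vertices:
  assumes "simple_graph V E" and "(u, v) \<in> (adj E)\<^sup>*" and "u \<in> V"
  shows "v \<in> V"
  using assms(2,3) by induction (use simple_graph_edgeD[OF assms(1)] in auto)

lemma reachable_iff_linked:
  assumes "simple_graph V E" and "u \<in> V"
  shows "reachable V E u v \<longleftrightarrow> (u, v) \<in> (adj E)\<^sup>*"
  unfolding reachable_def
  using walk_linked distinct_walk_exists[OF assms(1)] linked_in_vertices[OF assms(1) _ assms(2)]
  by metis

section \<open>Components as classes of linked vertices\<close>

lemma components_eq:
  assumes "simple_graph V E"
  shows "components V E = (\<lambda>u. {v \<in> V. (u, v) \<in> (adj E)\<^sup>*}) ` V"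
  unfolding components_def using reachable_iff_linked[OF assms] by (auto simp: image_def)

lemma component_eq_iff:
  assumes "u \<in> V" and "w \<in> V"
  shows "{v \<in> V. (u, v) \<in> (adj E)\<^sup>*} = {v \<in> V. (w, v) \<in> (adj E)\<^sup>*} \<longleftrightarrow> (u, w) \<in> (adj E)\<^sup>*"
proof
  assume "{v \<in> V. (u, v) \<in> (adj E)\<^sup>*} = {v \<in> V. (w, v) \<in> (adj E)\<^sup>*}"
  then show "(u, w) \<in> (adj E)\<^sup>*" using assms by blast
next
  assume "(u, w) \<in> (adj E)\<^sup>*"
  then show "{v \<in> V. (u, v) \<in> (adj E)\<^sup>*} = {v \<in> V. (w, v) \<in> (adj E)\<^sup>*}"
    using linked_left_cong by fastforce
qed

text \<open>Components are equivalence classes of linkedness, so the clause with A and B in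
  \<open>num_separating_forests\<close> reduces to a statement about i and j alone.\<close>

lemma in_distinct_components_iff:
  assumes "simple_graph V E" and "i \<in> V" and "j \<in> V"
  shows "(\<exists>A\<in>components V E. \<exists>B\<in>components V E. A \<noteq> B \<and> i \<in> A \<and> j \<in> B)
    \<longleftrightarrow> (i, j) \<notin> (adj E)\<^sup>*"
proof
  assume "\<exists>A\<in>components V E. \<exists>B\<in>components V E. A \<noteq> B \<and> i \<in> A \<and> j \<in> B"
  then obtain a b where ab: "a \<in> V" "b \<in> V" "(a, i) \<in> (adj E)\<^sup>*" "(b, j) \<in> (adj E)\<^sup>*"
    "(a, b) \<notin> (adj E)\<^sup>*"
    unfolding components_eq[OF assms(1)] by (auto simp: component_eq_iff)
  then show "(i, j) \<notin> (adj E)\<^sup>*"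
    using linked_left_cong[OF ab(3)] linked_left_cong[OF ab(4)] linked_sym by metis
next
  assume "(i, j) \<notin> (adj E)\<^sup>*"
  then have "{v \<in> V. (i, v) \<in> (adj E)\<^sup>*} \<noteq> {v \<in> V. (j, v) \<in> (adj E)\<^sup>*}"
    by (simp add: component_eq_iff[OF assms(2,3)])
  moreover have "{v \<in> V. (u, v) \<in> (adj E)\<^sup>*} \<in> components V E" if "u \<in> V" for u
    using that by (simp add: components_eq[OF assms(1)])
  ultimately show "\<exists>A\<in>components V E. \<exists>B\<in>components V E. A \<noteq> B \<and> i \<in> A \<and> j \<in> B"
    by (intro bexI[of _ "{v \<in> V. (i, v) \<in> (adj E)\<^sup>*}"] bexI[of _ "{v \<in> V. (j, v) \<in> (adj E)\<^sup>*}"])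
      (simp_all add: assms)
qed

section \<open>Removing edges from a tree\<close>

text \<open>A path from a to b that avoids the edge would be closed by it to a cycle.\<close>

lemma forest_edge_bridge:
  assumes "forest V E" and "{a, b} \<in> E"
  shows "(a, b) \<notin> (adj (E - {{a, b}}))\<^sup>*"
proof
  assume *: "(a, b) \<in> (adj (E - {{a, b}}))\<^sup>*"
  have sg: "simple_graph V E" using assms by (simp add: forest_def)
  note ab = simple_graph_edgeD[OF sg assms(2)]
  obtain xs where xs: "walk_betw V (E - {{a, b}}) a xs b" "distinct xs"
    using distinct_walk_exists[OF simple_graph_subset[OF sg Diff_subset] * ab(2)] by blast
  \<comment> \<open>One vertex would force a = b, and two vertices would traverse the deleted
    edge.\<close>
  have "3 \<le> length xs"
  proof (rule ccontr)
    assume "\<not> 3 \<le> length xs"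
    then have "length xs = 0 \<or> length xs = 1 \<or> length xs = 2" by linarith
    then show False using xs ab
      by (auto simp: walk_betw_def walk_def length_Suc_conv numeral_2_eq_2)
  qed
  moreover have "{last xs, hd xs} \<in> E"
    using xs assms(2) by (simp add: walk_betw_def insert_commute)
  ultimately have "cycle V E xs"
    using xs walk_mono[OF _ Diff_subset] by (auto simp: cycle_def walk_betw_def)
  then show False using assms by (auto simp: forest_def)
qed

lemma forest_subset: "forest V E \<Longrightarrow> H \<subseteq> E \<Longrightarrow> forest V H"
  unfolding forest_def cycle_def
  by (meson simple_graph_subset walk_mono subsetD)

lemma tree_forest: "tree V E \<Longrightarrow> forest V E"
  and tree_simple: "tree V E \<Longrightarrow> simple_graph V E"
  by (auto simp: tree_def forest_def)

lemma tree_linked: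
  assumes "tree V E" "u \<in> V" "v \<in> V"
  shows "(u, v) \<in> (adj E)\<^sup>*"
  using assms reachable_iff_linked[OF tree_simple[OF assms(1)]]
  by (auto simp: tree_def connected_graph_def)

text \<open>Follow a walk from a to v in the whole tree: each crossing of the deleted edge ends in a
  or b, where the trivial link starts afresh.\<close>

lemma tree_remove_edge_cover:
  assumes "tree V E" and "{a, b} \<in> E" and "v \<in> V"
  shows "(a, v) \<in> (adj (E - {{a, b}}))\<^sup>* \<or> (b, v) \<in> (adj (E - {{a, b}}))\<^sup>*"
proof -
  have "a \<in> V" using simple_graph_edgeD[OF tree_simple[OF assms(1)] assms(2)] by simp
  from tree_linked[OF assms(1) this assms(3)] show ?thesis
  proof (induction rule: rtrancl_induct)
    case (step y z)
    show ?case
    proof (cases "{y, z} = {a, b}")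
      case True
      then have "z = a \<or> z = b" by auto
      then show ?thesis by auto
    next
      case False
      then have "(y, z) \<in> adj (E - {{a, b}})" using step by simp
      then show ?thesis using step by (meson rtrancl_into_rtrancl)
    qed
  qed simp
qed

section \<open>Spanning trees and 2-tree spanning forests of a tree\<close>

lemma spanning_trees_tree:
  assumes "tree V E"
  shows "spanning_trees V E = {E}"
proof -
  have "H = E" if H: "H \<subseteq> E" "tree V H" for H
  proof (rule ccontr)
    assume "H \<noteq> E"
    then obtain e where e: "e \<in> E" "e \<notin> H" using H by auto
    obtain a b where ab: "e = {a, b}" "a \<in> V" "b \<in> V"
      using simple_graph_edgeE[OF tree_simple[OF assms] e(1)] by metis
    \<comment> \<open>The tree H links the ends of e without using e, although e is a bridge of
      E.\<close>
    have "(a, b) \<in> (adj (E - {e}))\<^sup>*"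
      by (rule linked_mono[OF tree_linked[OF H(2) ab(2,3)]]) (use H e in blast)
    then show False using forest_edge_bridge[OF tree_forest[OF assms]] ab e by simp
  qed
  then show ?thesis using assms by (auto simp: spanning_trees_def)
qed

lemma two_tree_forests_tree:
  assumes "tree V E"
  shows "two_tree_forests V E = (\<lambda>e. E - {e}) ` E"
proof (intro equalityI subsetI)
  note sg = tree_simple[OF assms] and fo = tree_forest[OF assms]
  fix H assume "H \<in> (\<lambda>e. E - {e}) ` E"
  then obtain e where e: "e \<in> E" "H = E - {e}" by auto
  obtain a b where ab: "e = {a, b}" "a \<in> V" "b \<in> V"
    using simple_graph_edgeE[OF sg e(1)] by metis
  let ?C = "\<lambda>u. {v \<in> V. (u, v) \<in> (adj H)\<^sup>*}"
  \<comment> \<open>Every vertex stays linked to an end of e, so there are at most two components;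
    the bridge property keeps them apart.\<close>
  have "?C u \<in> {?C a, ?C b}" if "u \<in> V" for u
    using tree_remove_edge_cover[OF assms, of a b u] component_eq_iff[of a V u H]
      component_eq_iff[of b V u H] that ab e by auto
  then have "components V H = {?C a, ?C b}"
    using components_eq[OF simple_graph_subset[OF sg, of H]] e ab by auto
  moreover have "?C a \<noteq> ?C b"
    using component_eq_iff[of a V b H] forest_edge_bridge[OF fo, of a b] ab e by simp
  ultimately show "H \<in> two_tree_forests V E"
    using forest_subset[OF fo] e by (auto simp: two_tree_forests_def)
next
  note sg = tree_simple[OF assms] and fo = tree_forest[OF assms]
  fix H assume "H \<in> two_tree_forests V E"
  then have H: "H \<subseteq> E" "card (components V H) = 2" by (auto simp: two_tree_forests_def)
  have sgH: "simple_graph V H" using simple_graph_subset[OF sg H(1)] .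
  let ?C = "\<lambda>u. {v \<in> V. (u, v) \<in> (adj H)\<^sup>*}"
  have "H \<noteq> E"
  proof
    assume "H = E"
    then have "?C u = V" if "u \<in> V" for u
      using tree_linked[OF assms that] by auto
    then have "X = V" if "X \<in> components V H" for X
      using that by (auto simp: components_eq[OF sgH])
    then show False using H(2) by (metis card_2_iff insertCI)
  qed
  then obtain e where e: "e \<in> E" "e \<notin> H" using H by auto
  obtain a b where ab: "e = {a, b}" "a \<in> V" "b \<in> V"
    using simple_graph_edgeE[OF sg e(1)] by metis
  have "H = E - {e}"
  proof (rule ccontr)
    assume "H \<noteq> E - {e}"
    \<comment> \<open>A second missing edge f would give three components, represented by its ends c
      and d and by a suitable end x of e.\<close>
    then obtain f where f: "f \<in> E" "f \<noteq> e" "f \<notin> H" using H e by auto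
    obtain c d where cd: "f = {c, d}" "c \<in> V" "d \<in> V"
      using simple_graph_edgeE[OF sg f(1)] by metis
    \<comment> \<open>Otherwise c would link the two ends of the bridge e. The end that is not
      linked to c serves as x.\<close>
    have "\<not> ((a, c) \<in> (adj (E - {e}))\<^sup>* \<and> (b, c) \<in> (adj (E - {e}))\<^sup>*)"
      using forest_edge_bridge[OF fo] ab e by (metis linked_sym rtrancl_trans)
    then obtain x where x: "x \<in> V" "(x, c) \<notin> (adj (E - {e}))\<^sup>*" using ab by auto
    \<comment> \<open>The edge f survives the deletion of e, so x is cut off from d as well as from
      c.\<close>
    have "(c, d) \<in> (adj (E - {e}))\<^sup>*" by (rule edge_linked) (use f cd in auto)
    then have "(x, d) \<notin> (adj (E - {e}))\<^sup>*"
      using x(2) rtrancl_trans[OF _ linked_sym, of x d _ c] by blast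
    moreover have "H \<subseteq> E - {e}" "H \<subseteq> E - {f}" using H e f by auto
    moreover have "(c, d) \<notin> (adj (E - {f}))\<^sup>*"
      using forest_edge_bridge[OF fo] f cd by simp
    ultimately have "(x, c) \<notin> (adj H)\<^sup>*" "(x, d) \<notin> (adj H)\<^sup>*" "(c, d) \<notin> (adj H)\<^sup>*"
      using x(2) linked_mono[of x c H "E - {e}"] linked_mono[of x d H "E - {e}"]
        linked_mono[of c d H "E - {f}"] by blast+
    then have "?C x \<noteq> ?C c" "?C x \<noteq> ?C d" "?C c \<noteq> ?C d"
      using component_eq_iff[of x V c H] component_eq_iff[of x V d H]
        component_eq_iff[of c V d H] x cd by blast+
    then have "card {?C x, ?C c, ?C d} = 3" by simp
    moreover have "{?C x, ?C c, ?C d} \<subseteq> components V H"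
      using components_eq[OF sgH] x cd by auto
    \<comment> \<open>An infinite set would have cardinality 0, not 2.\<close>
    moreover have "finite (components V H)" using H(2) card.infinite by fastforce
    ultimately show False
      using H(2) card_mono[of "components V H" "{?C x, ?C c, ?C d}"] by linarith
  qed
  then show "H \<in> (\<lambda>e. E - {e}) ` E" using e by blast
qed

section \<open>Separating edges\<close>

text \<open>In a tree these are the edges of the path between i and j. They index the separating
  forests by the deleted edge.\<close>

definition sep_edges :: "'a set set \<Rightarrow> 'a \<Rightarrow> 'a \<Rightarrow> 'a set set" where
  "sep_edges E i j = {e \<in> E. (i, j) \<notin> (adj (E - {e}))\<^sup>*}"

lemma num_separating_forests_tree:
  assumes "tree V E" and "i \<in> V" and "j \<in> V"
  shows "num_separating_forests V E i j = card (sep_edges E i j)"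
proof -
  have "{H \<in> two_tree_forests V E.
       \<exists>A\<in>components V H. \<exists>B\<in>components V H. A \<noteq> B \<and> i \<in> A \<and> j \<in> B}
     = {H \<in> two_tree_forests V E. (i, j) \<notin> (adj H)\<^sup>*}"
    using in_distinct_components_iff[OF simple_graph_subset[OF tree_simple[OF assms(1)]] assms(2,3)]
    by (auto simp: two_tree_forests_def)
  also have "\<dots> = (\<lambda>e. E - {e}) ` sep_edges E i j"
    unfolding two_tree_forests_tree[OF assms(1)] sep_edges_def by auto
  finally have "num_separating_forests V E i j = card ((\<lambda>e. E - {e}) ` sep_edges E i j)"
    by (simp add: num_separating_forests_def)
  \<comment> \<open>Deleting different edges of E leaves different edge sets.\<close>
  also have "\<dots> = card (sep_edges E i j)"
    by (rule card_image) (auto simp: inj_on_def sep_edges_def)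
  finally show ?thesis .
qed

lemma sep_edges_refl [simp]: "sep_edges E j j = {}"
  by (simp add: sep_edges_def)

lemma sep_edges_commute: "sep_edges E i j = sep_edges E j i"
  unfolding sep_edges_def using linked_sym by metis

text \<open>The last hypothesis puts j on the side of k, so the bridge \<open>{i, k}\<close>
  separates i from j but not k from j. Any other edge leaves i and k linked, hence separates both or
  neither from j.\<close>

lemma sep_edges_adjacent:
  assumes "tree V E" and "{i, k} \<in> E" and "(k, j) \<in> (adj (E - {{i, k}}))\<^sup>*"
  shows "sep_edges E i j = insert {i, k} (sep_edges E k j)" "{i, k} \<notin> sep_edges E k j"
proof -
  have br: "(i, k) \<notin> (adj (E - {{i, k}}))\<^sup>*"
    by (rule forest_edge_bridge[OF tree_forest[OF assms(1)] assms(2)])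
  then have "{i, k} \<in> sep_edges E i j"
    unfolding sep_edges_def using assms(2,3) by (auto dest: linked_sym intro: rtrancl_trans)
  moreover have "e \<in> sep_edges E i j \<longleftrightarrow> e \<in> sep_edges E k j" if "e \<noteq> {i, k}" for e
  proof -
    have "(i, k) \<in> (adj (E - {e}))\<^sup>*" using that assms(2) by (intro edge_linked) auto
    then show ?thesis by (simp add: sep_edges_def linked_left_cong[of i k])
  qed
  ultimately have "e \<in> sep_edges E i j \<longleftrightarrow> e \<in> insert {i, k} (sep_edges E k j)" for e
    by (cases "e = {i, k}") simp_all
  then show "sep_edges E i j = insert {i, k} (sep_edges E k j)"
    by blast
  show "{i, k} \<notin> sep_edges E k j" using assms(3) by (simp add: sep_edges_def)
qed

lemma card_sep_edges_adjacent:
  assumes "tree V E" and "{i, k} \<in> E" and "(k, j) \<in> (adj (E - {{i, k}}))\<^sup>*"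
  shows "card (sep_edges E i j) = Suc (card (sep_edges E k j))"
proof -
  have "finite (sep_edges E k j)"
    using simple_graph_finite_edges[OF tree_simple[OF assms(1)]] by (simp add: sep_edges_def)
  then show ?thesis using sep_edges_adjacent[OF assms] by simp
qed

section \<open>Distance as the number of separating edges\<close>

lemma card_sep_edges_step:
  assumes "tree V E" and "{i, k} \<in> E" and "j \<in> V"
  shows "card (sep_edges E i j) \<le> Suc (card (sep_edges E k j))"
proof -
  \<comment> \<open>The vertex j lies on the side of i or of k. The edge is written
    \<open>{k, i}\<close> in the first case to suit \<open>card_sep_edges_adjacent\<close> with the
    roles of i and k exchanged.\<close>
  consider "(i, j) \<in> (adj (E - {{k, i}}))\<^sup>*" | "(k, j) \<in> (adj (E - {{i, k}}))\<^sup>*"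
    using tree_remove_edge_cover[OF assms] by (auto simp: insert_commute)
  then show ?thesis
    using card_sep_edges_adjacent[OF assms(1), of k i j] card_sep_edges_adjacent[OF assms(1,2), of j]
      assms(2) by cases (auto simp: insert_commute)
qed

lemma card_sep_edges_le_walk:
  assumes "tree V E" and "walk V E xs"
  shows "Suc (card (sep_edges E (hd xs) (last xs))) \<le> length xs"
  using assms(2)
proof (induction xs rule: induct_list012)
  case (3 x y xs)
  have "last (y # xs) \<in> V" using 3(3) last_in_set unfolding walk_def by fastforce
  then show ?case using 3 card_sep_edges_step[OF assms(1), of x y "last (y # xs)"] by simp
qed (auto simp: walk_def)

text \<open>The rest of the walk never visits x, so it uses no edge at x. This supplies the last
  hypothesis of \<open>sep_edges_adjacent\<close> along a path.\<close>

lemma distinct_walk_first_edge: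
  assumes "walk V E (x # y # ys)" and "x \<notin> set (y # ys)"
  shows "(y, last (y # ys)) \<in> (adj (E - {{x, y}}))\<^sup>*"
proof -
  have "walk V {e \<in> E. x \<notin> e} (y # ys)" using assms walk_avoid[of V E "y # ys" x] by simp
  then have "(y, last (y # ys)) \<in> (adj {e \<in> E. x \<notin> e})\<^sup>*"
    by (intro walk_linked[of V _ _ "y # ys"]) (auto simp: walk_betw_def)
  then show ?thesis by (rule linked_mono) auto
qed

lemma card_sep_edges_distinct_walk:
  assumes "tree V E" and "walk V E xs" and "distinct xs"
  shows "Suc (card (sep_edges E (hd xs) (last xs))) = length xs"
  using assms(2,3)
proof (induction xs rule: induct_list012)
  case (3 x y xs)
  then show ?case
    using card_sep_edges_adjacent[OF assms(1) _ distinct_walk_first_edge[of V E x y xs]] by simp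
qed (auto simp: walk_def)

text \<open>The number of separating edges bounds the length of every walk from below, and a walk
  without repeated vertices attains it. The \<open>Suc\<close> accounts for a walk having one vertex
  more than edges.\<close>

lemma graph_dist_tree:
  assumes "tree V E" and "i \<in> V" and "j \<in> V"
  shows "graph_dist V E i j = card (sep_edges E i j)"
  unfolding graph_dist_def
proof (rule Least_equality)
  obtain xs where "walk_betw V E i xs j" "distinct xs"
    using distinct_walk_exists[OF tree_simple[OF assms(1)] tree_linked[OF assms] assms(3)] by blast
  then show "\<exists>xs. walk_betw V E i xs j \<and> length xs = Suc (card (sep_edges E i j))"
    using card_sep_edges_distinct_walk[OF assms(1)] by (auto simp: walk_betw_def)
next
  fix k assume "\<exists>xs. walk_betw V E i xs j \<and> length xs = Suc k"
  then show "card (sep_edges E i j) \<le> k"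
    using card_sep_edges_le_walk[OF assms(1)] by (fastforce simp: walk_betw_def)
qed

section \<open>Degree sums\<close>

text \<open>Double counting of the incident pairs of a vertex and an edge, with weight g at the
  vertex.\<close>

lemma sum_degree:
  fixes g :: "'a \<Rightarrow> real"
  assumes "simple_graph V E"
  shows "(\<Sum>i\<in>V. real (degree E i) * g i) = (\<Sum>e\<in>E. \<Sum>i\<in>e. g i)"
proof -
  have fin: "finite V" "finite E" using assms simple_graph_finite_edges
    by (auto simp: simple_graph_def)
  have "(\<Sum>i\<in>V. real (degree E i) * g i) = (\<Sum>i\<in>V. \<Sum>e\<in>{e \<in> E. i \<in> e}. g i)"
    by (simp add: degree_def)
  also have "\<dots> = (\<Sum>i\<in>V. \<Sum>e\<in>E. if i \<in> e then g i else 0)"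
    using fin by (simp only: sum.inter_filter)
  also have "\<dots> = (\<Sum>e\<in>E. \<Sum>i\<in>V. if i \<in> e then g i else 0)"
    by (rule sum.swap)
  also have "\<dots> = (\<Sum>e\<in>E. \<Sum>i\<in>e. g i)"
  proof (rule sum.cong[OF refl])
    fix e assume "e \<in> E"
    then have "{i \<in> V. i \<in> e} = e" using assms by (auto simp: simple_graph_def)
    then show "(\<Sum>i\<in>V. if i \<in> e then g i else 0) = (\<Sum>i\<in>e. g i)"
      using fin by (simp flip: sum.inter_filter)
  qed
  finally show ?thesis .
qed

section \<open>Rooting a tree at a vertex\<close>

text \<open>The condition on \<open>k\<close> says that \<open>{i, k}\<close> is the first edge on the path from \<open>i\<close> to \<open>j\<close>.\<close>

lemma parent_edge_exists:
  assumes "tree V E" and "i \<in> V" and "j \<in> V" and "i \<noteq> j"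
  obtains k where "{i, k} \<in> E" and "(k, j) \<in> (adj (E - {{i, k}}))\<^sup>*"
proof -
  obtain xs where xs: "walk_betw V E i xs j" "distinct xs"
    using distinct_walk_exists[OF tree_simple[OF assms(1)] tree_linked[OF assms(1-3)] assms(3)]
    by blast
  \<comment> \<open>\<open>remdups_adj.cases\<close> only provides the split into lists of length 0,
    1 and at least 2; the first two are excluded by i \<noteq> j.\<close>
  then obtain k ys where "xs = i # k # ys"
    using assms(4) by (cases xs rule: remdups_adj.cases) (auto simp: walk_betw_def walk_def)
  then show thesis
    using that[of k] xs distinct_walk_first_edge[of V E i k ys] by (simp add: walk_betw_def)
qed

text \<open>A walk from l to j that avoids \<open>{i, l}\<close> cannot meet i, so it survives the
  deletion of \<open>{i, k}\<close>. For k \<noteq> l, going from i to l, on to j and back to k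
  would bypass the bridge \<open>{i, k}\<close>.\<close>

lemma parent_edge_unique:
  assumes "tree V E" and "j \<in> V"
    and "{i, k} \<in> E" and "(k, j) \<in> (adj (E - {{i, k}}))\<^sup>*"
    and "{i, l} \<in> E" and "(l, j) \<in> (adj (E - {{i, l}}))\<^sup>*"
  shows "k = l"
proof (rule ccontr)
  assume "k \<noteq> l"
  note sg = tree_simple[OF assms(1)]
  obtain xs where xs: "walk_betw V (E - {{i, l}}) l xs j"
    using distinct_walk_exists[OF simple_graph_subset[OF sg Diff_subset] assms(6,2)] by blast
  have "i \<notin> set xs"
    using walk_linked_hd[of V "E - {{i, l}}" xs i] xs linked_sym[of l i "E - {{i, l}}"]
      forest_edge_bridge[OF tree_forest[OF assms(1)] assms(5)]
    by (auto simp: walk_betw_def)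
  then have "walk_betw V {e \<in> E - {{i, l}}. i \<notin> e} l xs j"
    using xs walk_avoid[of V "E - {{i, l}}" xs i] by (auto simp: walk_betw_def)
  then have "(l, j) \<in> (adj (E - {{i, k}}))\<^sup>*"
    by (intro linked_mono[OF walk_linked]) auto
  moreover have "(i, l) \<in> (adj (E - {{i, k}}))\<^sup>*"
    using assms(5) \<open>k \<noteq> l\<close> by (intro edge_linked) (auto simp: doubleton_eq_iff)
  ultimately have "(i, k) \<in> (adj (E - {{i, k}}))\<^sup>*"
    using assms(4) by (meson linked_sym rtrancl_trans)
  then show False using forest_edge_bridge[OF tree_forest[OF assms(1)] assms(3)] by blast
qed

text \<open>The map p sends a vertex to its parent in the tree rooted at j. The number of separating
  edges serves as the depth.\<close>

lemma parent_map:
  assumes "tree V E" and "j \<in> V"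
  obtains p where "bij_betw (\<lambda>i. {i, p i}) (V - {j}) E"
    and "\<And>i. i \<in> V - {j} \<Longrightarrow> {i, p i} \<in> E"
    and "\<And>i. i \<in> V - {j} \<Longrightarrow> card (sep_edges E i j) = Suc (card (sep_edges E (p i) j))"
proof -
  have "\<forall>i\<in>V - {j}. \<exists>k. {i, k} \<in> E \<and> (k, j) \<in> (adj (E - {{i, k}}))\<^sup>*"
    using parent_edge_exists[OF assms(1) _ assms(2)] by (metis DiffE singletonI)
  then obtain p where p: "\<And>i. i \<in> V - {j} \<Longrightarrow> {i, p i} \<in> E"
      "\<And>i. i \<in> V - {j} \<Longrightarrow> (p i, j) \<in> (adj (E - {{i, p i}}))\<^sup>*"
    by metis
  have s: "card (sep_edges E i j) = Suc (card (sep_edges E (p i) j))" if "i \<in> V - {j}" for i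
    using card_sep_edges_adjacent[OF assms(1) p(1)[OF that] p(2)[OF that]] .
  have "inj_on (\<lambda>i. {i, p i}) (V - {j})"
  proof (rule inj_onI)
    fix x y assume "x \<in> V - {j}" "y \<in> V - {j}" "{x, p x} = {y, p y}"
    \<comment> \<open>Otherwise x and y would be parents of each other, and each would be deeper
      than the other.\<close>
    then show "x = y" using s[of x] s[of y] by (auto simp: doubleton_eq_iff)
  qed
  moreover have "E \<subseteq> (\<lambda>i. {i, p i}) ` (V - {j})"
  proof
    fix e assume e: "e \<in> E"
    obtain a b where ab: "e = {a, b}"
      using simple_graph_edgeE[OF tree_simple[OF assms(1)] e] by metis
    \<comment> \<open>The ends of e are named so that k is the one on the side of j; then e is the
      parent edge of i.\<close>
    then obtain i k where ik: "e = {i, k}" "(k, j) \<in> (adj (E - {{i, k}}))\<^sup>*"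
      using tree_remove_edge_cover[OF assms(1) _ assms(2), of a b] e
      by (metis insert_commute)
    have "i \<noteq> j"
      using forest_edge_bridge[OF tree_forest[OF assms(1)], of i k] ik e linked_sym by metis
    then have i: "i \<in> V - {j}"
      using simple_graph_edgeD[OF tree_simple[OF assms(1)], of i k] ik e by simp
    then have "k = p i" using parent_edge_unique[OF assms, of i k "p i"] p ik e by simp
    then show "e \<in> (\<lambda>i. {i, p i}) ` (V - {j})" using ik i by auto
  qed
  ultimately have "bij_betw (\<lambda>i. {i, p i}) (V - {j}) E"
    using p(1) by (auto simp: bij_betw_def)
  then show thesis using that p(1) s by blast
qed

lemma card_tree_edges:
  assumes "tree V E"
  shows "Suc (card E) = card V"
proof -
  obtain j where j: "j \<in> V" using assms by (auto simp: tree_def connected_graph_def)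
  then have "card (V - {j}) = card E"
    using parent_map[OF assms j] bij_betw_same_card by metis
  moreover have "finite V" using tree_simple[OF assms] by (simp add: simple_graph_def)
  ultimately show ?thesis using j by (metis card_Suc_Diff1)
qed

lemma sum_degree_sep_edges:
  assumes "tree V E" and "j \<in> V"
  shows "(\<Sum>i\<in>V. real (degree E i) * real (card (sep_edges E i j)))
    = 2 * (\<Sum>i\<in>V. real (card (sep_edges E i j))) - (real (card V) - 1)"
proof -
  let ?s = "\<lambda>i. real (card (sep_edges E i j))"
  note sg = tree_simple[OF assms(1)]
  have fin: "finite V" using sg by (simp add: simple_graph_def)
  obtain p where p: "bij_betw (\<lambda>i. {i, p i}) (V - {j}) E"
    "\<And>i. i \<in> V - {j} \<Longrightarrow> {i, p i} \<in> E"
    "\<And>i. i \<in> V - {j} \<Longrightarrow> card (sep_edges E i j) = Suc (card (sep_edges E (p i) j))"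
    by (rule parent_map[OF assms]) (blast intro: that)
  have "(\<Sum>i\<in>V. real (degree E i) * ?s i) = (\<Sum>i\<in>V - {j}. \<Sum>v\<in>{i, p i}. ?s v)"
    by (simp only: sum_degree[OF sg] sum.reindex_bij_betw[OF p(1)])
  \<comment> \<open>The parent is one level higher, so an edge contributes ?s i + (?s i -
    1).\<close>
  also have "\<dots> = (\<Sum>i\<in>V - {j}. 2 * ?s i - 1)"
  proof (rule sum.cong[OF refl])
    fix i assume i: "i \<in> V - {j}"
    then have "i \<noteq> p i" using simple_graph_edgeD[OF sg p(2)] by blast
    then show "(\<Sum>v\<in>{i, p i}. ?s v) = 2 * ?s i - 1" using p(3)[OF i] by simp
  qed
  also have "\<dots> = 2 * (\<Sum>i\<in>V - {j}. ?s i) - real (card (V - {j}))"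
    by (simp add: sum_subtractf sum_distrib_left)
  \<comment> \<open>The root may be added back because its term is 0.\<close>
  also have "(\<Sum>i\<in>V - {j}. ?s i) = (\<Sum>i\<in>V. ?s i)"
    using fin assms(2) by (subst (2) sum.remove) auto
  also have "real (card (V - {j})) = real (card V) - 1"
    using fin assms(2) by (metis card_Suc_Diff1 of_nat_Suc add_diff_cancel_left')
  finally show ?thesis .
qed

lemma degree_quadratic_form:
  assumes "tree V E"
  shows "(\<Sum>i\<in>V. \<Sum>j\<in>V. real (degree E i) * real (card (sep_edges E i j)) * real (degree E j))
    = 4 * (\<Sum>i\<in>V. \<Sum>j\<in>V. real (card (sep_edges E i j)))
      - 2 * (real (card V) - 1) * (2 * real (card V) - 1)"
proof -
  let ?s = "\<lambda>i j. real (card (sep_edges E i j))" and ?d = "\<lambda>i. real (degree E i)"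
  let ?n = "real (card V)" and ?S = "\<Sum>i\<in>V. \<Sum>j\<in>V. real (card (sep_edges E i j))"
  \<comment> \<open>Handshake identity, obtained from \<open>sum_degree\<close> with weight
    1.\<close>
  have "(\<Sum>i\<in>V. ?d i) = (\<Sum>i\<in>V. ?d i * 1)" by simp
  also have "\<dots> = (\<Sum>e\<in>E. real (card e))"
    unfolding sum_degree[OF tree_simple[OF assms]] by simp
  also have "\<dots> = 2 * real (card E)"
    using tree_simple[OF assms] by (simp add: simple_graph_def)
  finally have deg: "(\<Sum>i\<in>V. ?d i) = 2 * (?n - 1)"
    using card_tree_edges[OF assms] by (metis add_diff_cancel_left' of_nat_Suc)
  have "(\<Sum>i\<in>V. \<Sum>j\<in>V. ?d i * ?s i j * ?d j) = (\<Sum>j\<in>V. ?d j * (\<Sum>i\<in>V. ?d i * ?s i j))"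
    by (subst sum.swap) (simp add: sum_distrib_left mult_ac)
  also have "\<dots> = (\<Sum>j\<in>V. ?d j * (2 * (\<Sum>i\<in>V. ?s i j) - (?n - 1)))"
    by (intro sum.cong refl) (simp add: sum_degree_sep_edges[OF assms])
  also have "\<dots> = 2 * (\<Sum>j\<in>V. \<Sum>i\<in>V. ?d j * ?s i j) - (?n - 1) * (\<Sum>j\<in>V. ?d j)"
    by (simp add: right_diff_distrib sum_subtractf sum_distrib_left sum_distrib_right mult_ac)
  \<comment> \<open>Symmetry of separation makes i the root, so that the degree identity applies a
    second time.\<close>
  also have "(\<Sum>j\<in>V. \<Sum>i\<in>V. ?d j * ?s i j) = (\<Sum>i\<in>V. \<Sum>j\<in>V. ?d j * ?s j i)"
    by (subst sum.swap) (simp add: sep_edges_commute)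
  also have "\<dots> = (\<Sum>i\<in>V. 2 * (\<Sum>j\<in>V. ?s j i) - (?n - 1))"
    by (intro sum.cong refl) (simp add: sum_degree_sep_edges[OF assms])
  also have "\<dots> = 2 * (\<Sum>i\<in>V. \<Sum>j\<in>V. ?s j i) - ?n * (?n - 1)"
    by (simp add: sum_subtractf sum_distrib_left)
  also have "(\<Sum>i\<in>V. \<Sum>j\<in>V. ?s j i) = ?S"
    by (rule sum.swap)
  \<comment> \<open>The two applications contribute the corrections -2(n-1)^2 and -2n(n-1), which
    add up to -2(n-1)(2n-1).\<close>
  finally show ?thesis unfolding deg by (simp add: algebra_simps)
qed

section \<open>From matrix products to sums over the vertices\<close>

lemma vec_mat_vec_sum:
  fixes f :: "nat \<Rightarrow> real"
  shows "vec n (\<lambda>i. f (Suc i)) \<bullet> (mat n n (\<lambda>(i, j). g (Suc i) (Suc j)) *\<^sub>v vec n (\<lambda>i. f (Suc i)))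
    = (\<Sum>i\<in>{1..n}. \<Sum>j\<in>{1..n}. f i * g i j * f j)"
proof -
  have shift: "(\<Sum>i\<in>{1..n}. h i) = (\<Sum>i = 0..<n. h (Suc i))" for h :: "nat \<Rightarrow> real"
    using sum.shift_bounds_Suc_ivl[of h 0 n] by (simp add: atLeastLessThanSuc_atLeastAtMost)
  show ?thesis unfolding shift
    by (simp add: scalar_prod_def sum_distrib_left mult.assoc)
qed

theorem mainTheorem1:
  fixes n :: nat and T :: "nat set set"
  assumes "n \<ge> 2" and "tree {1..n} T"
  shows "kemeny n T =
           (ones_vec n \<bullet> (forest_mat n T *\<^sub>v ones_vec n)) / (real n - 1) - (2 * real n - 1) / 2
       \<and> (ones_vec n \<bullet> (forest_mat n T *\<^sub>v ones_vec n)) / (real n - 1) - (2 * real n - 1) / 2 =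
           2 * wiener_index n T / (real n - 1) - real n + 1 / 2"
proof -
  let ?s = "\<lambda>i j. real (card (sep_edges T i j))"
  define S where "S = (\<Sum>i\<in>{1..n}. \<Sum>j\<in>{1..n}. ?s i j)"
  have F: "forest_mat n T = mat n n (\<lambda>(i, j). ?s (Suc i) (Suc j))"
    unfolding forest_mat_def
    \<comment> \<open>Removing \<open>One_nat_def\<close> keeps the vertex set in the form
      \<open>{1..n}\<close>, in which the instantiated fact is stated.\<close>
    by (rule cong_mat) (simp_all add: num_separating_forests_tree[OF assms(2)] del: One_nat_def)
  \<comment> \<open>On a tree the entries of both matrices count separating edges, which is what
    brings in the Wiener index.\<close>
  have D: "distance_mat n T = forest_mat n T"
    unfolding F distance_mat_def
    by (rule cong_mat) (simp_all add: graph_dist_tree[OF assms(2)] del: One_nat_def)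
  have ones: "ones_vec n \<bullet> (forest_mat n T *\<^sub>v ones_vec n) = S"
    unfolding F ones_vec_def S_def using vec_mat_vec_sum[of n "\<lambda>_. 1" ?s] by simp
  have "degree_vec n T \<bullet> (forest_mat n T *\<^sub>v degree_vec n T)
      = (\<Sum>i\<in>{1..n}. \<Sum>j\<in>{1..n}. real (degree T i) * ?s i j * real (degree T j))"
    unfolding F degree_vec_def by (rule vec_mat_vec_sum)
  also have "\<dots> = 4 * S - 2 * (real n - 1) * (2 * real n - 1)"
    using degree_quadratic_form[OF assms(2)] by (simp add: S_def)
  finally have quad: "degree_vec n T \<bullet> (forest_mat n T *\<^sub>v degree_vec n T)
      = 4 * S - 2 * (real n - 1) * (2 * real n - 1)" .
  have "real (card T) = real n - 1"
    using card_tree_edges[OF assms(2)] by simp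
  \<comment> \<open>A tree is its only spanning tree, so the denominator is 4(n-1).\<close>
  then have "kemeny n T = (4 * S - 2 * (real n - 1) * (2 * real n - 1)) / (4 * (real n - 1))"
    unfolding kemeny_def quad spanning_trees_tree[OF assms(2)] by simp
  also have "\<dots> = S / (real n - 1) - (2 * real n - 1) / 2"
    using assms(1) by (simp add: field_simps)
  finally have "kemeny n T = S / (real n - 1) - (2 * real n - 1) / 2" .
  moreover have "2 * wiener_index n T = S"
    unfolding wiener_index_def D ones by simp
  ultimately show ?thesis unfolding ones by (simp add: diff_divide_distrib)
qed

end
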